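(* For every prime power $q$, the number $I_{\mathrm{GH}}(q)$ of $\mathbb{F}_q$-isomorphism classes of generalized Hessian curves over $\mathbb{F}_q$ is $\lfloor 3(q+3)/4\rfloor$ if $q\equiv1\pmod3$, and $q-1$ if $q\equiv0,2\pmod3$.
   Context: For $u,v\in\mathbb{F}_q$ with $v\ne0$ and $u^3\ne27v$, the generalized Hessian curve $E_{\mathrm{GH},u,v}$ is the elliptic curve $X^3+Y^3+v=uXY$ over $\mathbb{F}_q$. Two such curves are $\mathbb{F}_q$-isomorphic if they are birationally equivalent over $\mathbb{F}_q$ (equivalently, their Weierstrass models are isomorphic via a Weierstrass change of variables $X\mapsto\alpha^2\tilde X+\beta$, $Y\mapsto\alpha^3\tilde Y+\alpha^2\gamma\tilde X+\delta$ with $\alpha,\beta,\gamma,\delta\in\mathbb{F}_q$, $\alpha\ne0$). $I_{\mathrm{GH}}(q)$ is the number of equivalence classes of $\{E_{\mathrm{GH},u,v}: u,v\in\mathbb{F}_q,\ v\ne0,\ u^3\ne27v\}$ under $\mathbb{F}_q$-isomorphism. *)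

theory Defs
  imports Main
begin

text \<open>Long Weierstrass equations
  y^2 + a1 x y + a3 y = x^3 + a2 x^2 + a4 x + a6
  are represented by their coefficient tuples (a1, a2, a3, a4, a6).\<close>

type_synonym 'a weier = "'a \<times> 'a \<times> 'a \<times> 'a \<times> 'a"

text \<open>The Weierstrass change of variables X = alpha^2 X' + beta,
  Y = alpha^3 Y' + alpha^2 gamma X' + delta transforms the equation with
  coefficients a into alpha^6 times the equation with coefficients b.
  Written out coefficientwise (the literal expansion of the substitution).\<close>

definition weier_change ::
  "'a::field \<Rightarrow> 'a \<Rightarrow> 'a \<Rightarrow> 'a \<Rightarrow> 'a weier \<Rightarrow> 'a weier \<Rightarrow> bool" where
  "weier_change \<alpha> \<beta> \<gamma> \<delta> a b \<longleftrightarrow>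
     (case a of (a1, a2, a3, a4, a6) \<Rightarrow> case b of (b1, b2, b3, b4, b6) \<Rightarrow>
        \<alpha> * b1 = a1 + 2 * \<gamma> \<and>
        \<alpha>^2 * b2 = a2 - \<gamma> * a1 + 3 * \<beta> - \<gamma>^2 \<and>
        \<alpha>^3 * b3 = a3 + \<beta> * a1 + 2 * \<delta> \<and>
        \<alpha>^4 * b4 = a4 - \<gamma> * a3 + 2 * \<beta> * a2 - (\<delta> + \<beta> * \<gamma>) * a1 + 3 * \<beta>^2 - 2 * \<gamma> * \<delta> \<and>
        \<alpha>^6 * b6 = a6 + \<beta> * a4 + \<beta>^2 * a2 + \<beta>^3 - \<delta> * a3 - \<delta>^2 - \<beta> * \<delta> * a1)"

definition weier_iso :: "'a::field weier \<Rightarrow> 'a weier \<Rightarrow> bool" where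
  "weier_iso a b \<longleftrightarrow> (\<exists>\<alpha> \<beta> \<gamma> \<delta>. \<alpha> \<noteq> 0 \<and> weier_change \<alpha> \<beta> \<gamma> \<delta> a b)"

text \<open>A Weierstrass model of the generalized Hessian curve X^3 + Y^3 + v = u X Y:
  y^2 + u x y - 9 v y = x^3 - v (u^3 + 27 v)
  (discriminant v (u^3 - 27 v)^3).  It is obtained by taking the rational flex
  (1:-1:0) at infinity as origin and its tangent 3X + 3Y + uZ = 0 as line at infinity.\<close>

definition GH_weier :: "'a::field \<Rightarrow> 'a \<Rightarrow> 'a weier" where
  "GH_weier u v = (u, 0, - 9 * v, 0, - v * (u^3 + 27 * v))"

definition GH_params :: "('a::field \<times> 'a) set" where
  "GH_params = {(u, v). v \<noteq> 0 \<and> u^3 \<noteq> 27 * v}"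

definition GH_iso_rel :: "(('a::field \<times> 'a) \<times> ('a \<times> 'a)) set" where
  "GH_iso_rel = {(p, p'). p \<in> GH_params \<and> p' \<in> GH_params \<and>
       weier_iso (GH_weier (fst p) (snd p)) (GH_weier (fst p') (snd p'))}"

definition I_GH :: "'a::{finite,field} itself \<Rightarrow> nat" where
  "I_GH _ = card ((GH_params :: ('a \<times> 'a) set) // GH_iso_rel)"

end

(*
  For 3 invertible, a Weierstrass isomorphism between two generalized Hessian curves is either
  the scaling (u, v) = (l u', l^3 v') or comes from exchanging the distinguished rational
  subgroup of order 3 (the flexes at infinity) for another one.  The second kind requires a
  primitive cube root of unity and v = c^3, v' = c'^3; in terms of the Hessian parameters
  x = u/c and x' = u'/c' it is the involution (x - 3) (x' - 3) = 27, i.e. x' = 3 (x + 6)/(x - 3),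
  which together with the cube roots of unity generates a group isomorphic to A4.

  Without a primitive cube root of unity, or in characteristic 3, only scalings occur and there
  are q - 1 classes.  Otherwise q = 3 m + 1.  The pairs with v a non-cube give 2 m classes with
  u \<noteq> 0 and 2 classes with u = 0.  The remaining classes are the A4-orbits on {x. x^3 \<noteq> 27}:
  they have 12 elements except for the orbit with c4 = 0 (j = 0), of size 4 (or 1 in
  characteristic 2), and at most one further orbit with c6 = 0 (j = 1728), of size 6.
*)
theory Submission
  imports Defs "HOL-Computational_Algebra.Polynomial"
begin

section \<open>Isomorphisms between generalized Hessian curves\<close>

definition gh_scaled :: "'a::field \<times> 'a \<Rightarrow> 'a \<times> 'a \<Rightarrow> bool" where
  "gh_scaled p p' \<longleftrightarrow> (\<exists>l. l \<noteq> 0 \<and> fst p = l * fst p' \<and> snd p = l^3 * snd p')"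

text \<open>The second disjunct of the isomorphism criterion: the Hessian parameters \<open>u / c\<close> and
  \<open>u' / c'\<close> correspond under \<open>(x - 3) (x' - 3) = 27\<close>.  The choices of \<open>c\<close> and \<open>c'\<close> among the
  cube roots account for the action of the cube roots of unity.\<close>

definition gh_linked :: "'a::field \<times> 'a \<Rightarrow> 'a \<times> 'a \<Rightarrow> bool" where
  "gh_linked p p' \<longleftrightarrow> (\<exists>(w::'a) c c'. w^2 + w + 1 = 0 \<and> snd p = c^3 \<and> snd p' = c'^3 \<and>
     (fst p - 3 * c) * (fst p' - 3 * c') = 27 * c * c')"

text \<open>Substituting one change of variables into the other gives the four coefficients; the
  mixed term in the last one comes from the shift of X inside the \<open>\<gamma>\<close>-term of
  Y.\<close>

lemma weier_change_comp:
  fixes a b c :: "'a::field weier"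
  assumes "weier_change \<alpha> \<beta> \<gamma> \<delta> a b" "weier_change \<alpha>' \<beta>' \<gamma>' \<delta>' b c"
  shows "weier_change (\<alpha> * \<alpha>') (\<beta> + \<alpha>^2 * \<beta>') (\<gamma> + \<alpha> * \<gamma>') (\<delta> + \<alpha>^3 * \<delta>' + \<alpha>^2 * \<beta>' * \<gamma>) a c"
proof -
  obtain a1 a2 a3 a4 a6 where a: "a = (a1,a2,a3,a4,a6)" by (cases a) auto
  obtain b1 b2 b3 b4 b6 where b: "b = (b1,b2,b3,b4,b6)" by (cases b) auto
  obtain c1 c2 c3 c4 c6 where c: "c = (c1,c2,c3,c4,c6)" by (cases c) auto
  show ?thesis using assms unfolding weier_change_def a b c prod.case
    by (elim conjE, intro conjI) algebra+
qed

lemma weier_iso_trans: "weier_iso a b \<Longrightarrow> weier_iso b c \<Longrightarrow> weier_iso a c"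
  unfolding weier_iso_def by (metis weier_change_comp mult_eq_0_iff)

text \<open>The primed parameters are kept in the combinations \<open>\<alpha> * u'\<close> and
  \<open>\<alpha>^3 * v'\<close>, so scaling plays no part in the later elimination of
  \<open>\<beta>\<close>, \<open>\<gamma>\<close> and \<open>\<delta>\<close>.\<close>

lemma weier_change_GH_weierD:
  fixes u v u' v' :: "'a::field"
  assumes "weier_change \<alpha> \<beta> \<gamma> \<delta> (GH_weier u v) (GH_weier u' v')"
  shows "\<alpha> * u' = u + 2 * \<gamma>"
    and "3 * \<beta> = \<gamma> * (u + \<gamma>)"
    and "9 * (\<alpha>^3 * v') = 9 * v - \<beta> * u - 2 * \<delta>"
    and "(\<delta> + \<beta> * \<gamma>) * u + 2 * \<gamma> * \<delta> = 9 * v * \<gamma> + 3 * \<beta>^2"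
    and "\<alpha>^3 * v' * ((\<alpha> * u')^3 + 27 * (\<alpha>^3 * v')) =
      v * (u^3 + 27 * v) - \<beta>^3 - 9 * \<delta> * v + \<delta>^2 + \<beta> * \<delta> * u"
proof -
  have ch: "\<alpha> * u' = u + 2 * \<gamma>" "\<alpha>^2 * 0 = 0 - \<gamma> * u + 3 * \<beta> - \<gamma>^2"
    "\<alpha>^3 * (- 9 * v') = - 9 * v + \<beta> * u + 2 * \<delta>"
    "\<alpha>^4 * 0 = 0 - \<gamma> * (- 9 * v) + 2 * \<beta> * 0 - (\<delta> + \<beta> * \<gamma>) * u + 3 * \<beta>^2 - 2 * \<gamma> * \<delta>"
    "\<alpha>^6 * (- v' * (u'^3 + 27 * v')) = - v * (u^3 + 27 * v) + \<beta> * 0 + \<beta>^2 * 0 + \<beta>^3 - \<delta> * (- 9 * v) - \<delta>^2 - \<beta> * \<delta> * u"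
    using assms unfolding weier_change_def GH_weier_def prod.case by blast+
  show "\<alpha> * u' = u + 2 * \<gamma>" by (fact ch(1))
  show "3 * \<beta> = \<gamma> * (u + \<gamma>)" using ch(2) by algebra
  show "9 * (\<alpha>^3 * v') = 9 * v - \<beta> * u - 2 * \<delta>" using ch(3) by algebra
  show "(\<delta> + \<beta> * \<gamma>) * u + 2 * \<gamma> * \<delta> = 9 * v * \<gamma> + 3 * \<beta>^2"
      using ch(4) by algebra
  show "\<alpha>^3 * v' * ((\<alpha> * u')^3 + 27 * (\<alpha>^3 * v')) =
      v * (u^3 + 27 * v) - \<beta>^3 - 9 * \<delta> * v + \<delta>^2 + \<beta> * \<delta> * u" using ch(5) by algebra
qed

section \<open>Explicit isomorphisms from scaling and linking\<close>

lemma scaled_imp_iso: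
  fixes u v u' v' :: "'a::field"
  assumes "gh_scaled (u, v) (u', v')"
  shows "weier_iso (GH_weier u v) (GH_weier u' v')"
proof -
  from assms obtain l where l: "l \<noteq> 0" "u = l * u'" "v = l^3 * v'"
    by (auto simp: gh_scaled_def)
  have "weier_change l 0 0 0 (GH_weier u v) (GH_weier u' v')"
    unfolding weier_change_def GH_weier_def prod.case l(2,3)
    by (simp add: power_mult_distrib algebra_simps)
  then show ?thesis using l(1) unfolding weier_iso_def by blast
qed

text \<open>The link equation is parametrized with a square root t = 2w + 1 of -3: for
  \<open>\<alpha> * c' = s\<close> it becomes u = 3c + 3ts and
  \<open>\<alpha> * u' = 3 * s - 3 * t * c\<close>. The coefficient equations are then polynomial
  identities in c, s and w.\<close>

lemma linked_imp_iso:
  fixes u v u' v' :: "'a::field"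
  assumes three: "(3::'a) \<noteq> 0" and v: "u^3 \<noteq> 27 * v" "v' \<noteq> 0"
    and link: "gh_linked (u, v) (u', v')"
  shows "weier_iso (GH_weier u v) (GH_weier u' v')"
proof -
  from link obtain w c c' :: 'a where w: "w^2 + w + 1 = 0" and c: "v = c^3" "v' = c'^3"
    and L: "(u - 3 * c) * (u' - 3 * c') = 27 * c * c'"
    by (auto simp: gh_linked_def)
  have nz: "c' \<noteq> 0" "u - 3 * c \<noteq> 0" using v c by (auto simp: power_mult_distrib)
  define t where "t = 2 * w + 1"
  have t2: "t^2 = -3" unfolding t_def using w by algebra
  hence t0: "t \<noteq> 0" using three by auto
  define s where "s = (u - 3 * c) / (3 * t)"
  have u: "u = 3 * c + 3 * t * s" using t0 three by (simp add: s_def)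
  have s0: "s \<noteq> 0" using nz t0 three by (simp add: s_def)
  define \<alpha> where "\<alpha> = s / c'"
  have al: "\<alpha> * c' = s" "\<alpha> \<noteq> 0" using nz s0 by (auto simp: \<alpha>_def)
  have "3 * t * s * (\<alpha> * u' - 3 * s) = 27 * c * s" using L al(1) unfolding u by algebra
  hence "3 * s * (t * (\<alpha> * u' - 3 * s) - 9 * c) = 0" by algebra
  hence "t * (\<alpha> * u' - 3 * s) = 9 * c" using s0 three by simp
  hence "3 * t * c = t * t * (\<alpha> * u' - 3 * s) - 6 * t * c" by algebra
  hence "3 * (\<alpha> * u' - 3 * s + 3 * t * c) = 0" unfolding t2[unfolded power2_eq_square] by algebra
  hence "\<alpha> * u' - 3 * s + 3 * t * c = 0" using three by (metis mult_eq_0_iff)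
  hence au: "\<alpha> * u' = 3 * s - 3 * t * c" by algebra
  define U where "U = c + t * s"
  \<comment> \<open>\<open>g\<close> is half of \<open>\<alpha> * u' - u\<close>, the shift of X
    used below is g (u + g) / 3, and \<open>d\<close> is half of what the third equation leaves.
    Writing them through \<open>w\<close> avoids division by 2, so characteristic 2 is
    covered.\<close>
  define g where "g = t * w * U - t * c"
  define d where "d = g * (w * U^2 + w^2 * c * U + (3 * w + 1) * c^2)"
  have uU: "u = 3 * U" by (simp add: u U_def algebra_simps)
  have "weier_change \<alpha> (- (c^2 + c * U + U^2)) g d (GH_weier u v) (GH_weier u' v')"
    unfolding weier_change_def GH_weier_def prod.case
  proof (intro conjI)
    show "\<alpha> * u' = u + 2 * g" unfolding au u g_def U_def t_def using w by algebra
    show "\<alpha>^2 * 0 = 0 - g * u + 3 * (- (c^2 + c * U + U^2)) - g^2"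
      unfolding uU g_def t_def using w by algebra
    have "\<alpha>^3 * (- 9 * v') = - 9 * s^3" unfolding c al(1)[symmetric] by algebra
    also have "\<dots> = - 9 * v + (- (c^2 + c * U + U^2)) * u + 2 * d"
      unfolding c uU d_def g_def U_def t_def using w by algebra
    finally show "\<alpha>^3 * (- 9 * v') = - 9 * v + (- (c^2 + c * U + U^2)) * u + 2 * d" .
    show "\<alpha>^4 * 0 = 0 - g * (- 9 * v) + 2 * (- (c^2 + c * U + U^2)) * 0
       - (d + (- (c^2 + c * U + U^2)) * g) * u + 3 * (- (c^2 + c * U + U^2))^2 - 2 * g * d"
      unfolding c uU d_def g_def t_def using w by algebra
    have "\<alpha>^6 * (- v' * (u'^3 + 27 * v')) = - ((\<alpha> * c')^3) * ((\<alpha> * u')^3 + 27 * (\<alpha> * c')^3)"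
      unfolding c by algebra
    also have "\<dots> = - (s^3) * ((3 * s - 3 * t * c)^3 + 27 * s^3)" unfolding al au ..
    also have "\<dots> = - v * (u^3 + 27 * v) + (- (c^2 + c * U + U^2)) * 0 + (- (c^2 + c * U + U^2))^2 * 0
      + (- (c^2 + c * U + U^2))^3 - d * (- 9 * v) - d^2 - (- (c^2 + c * U + U^2)) * d * u"
      unfolding c uU d_def g_def U_def t_def using w by algebra
    finally show "\<alpha>^6 * (- v' * (u'^3 + 27 * v')) = - v * (u^3 + 27 * v) + (- (c^2 + c * U + U^2)) * 0 + (- (c^2 + c * U + U^2))^2 * 0
      + (- (c^2 + c * U + U^2))^3 - d * (- 9 * v) - d^2 - (- (c^2 + c * U + U^2)) * d * u" .
  qed
  then show ?thesis using al unfolding weier_iso_def by blast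
qed

section \<open>Which changes of variables can occur\<close>

lemma iso_imp_scaled_char3:
  fixes u v u' v' :: "'a::field"
  assumes three: "(3::'a) = 0" and u: "u^3 \<noteq> 27 * v"
    and iso: "weier_iso (GH_weier u v) (GH_weier u' v')"
  shows "gh_scaled (u, v) (u', v')"
proof -
  have "(27::'a) = 9 * 3" and "(9::'a) = 3 * 3" and "(2::'a) = 3 - 1" by simp_all
  hence n: "(27::'a) = 0" "(9::'a) = 0" "(2::'a) = -1" unfolding three by simp_all
  have u0: "u \<noteq> 0" using u n by auto
  from iso obtain \<alpha> \<beta> \<gamma> \<delta> where al: "\<alpha> \<noteq> 0"
      and ch: "weier_change \<alpha> \<beta> \<gamma> \<delta> (GH_weier u v) (GH_weier u' v')"
    unfolding weier_iso_def by blast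
  note ch = weier_change_GH_weierD[OF ch, unfolded n three]
  have e: "\<alpha> * u' = u - \<gamma>" "\<gamma> * (u + \<gamma>) = 0" "\<delta> = \<beta> * u"
    "(\<delta> + \<beta> * \<gamma>) * u = \<gamma> * \<delta>"
    "\<alpha>^3 * v' * (\<alpha> * u')^3 = v * u^3 - \<beta>^3 + \<delta>^2 + \<beta> * \<delta> * u"
    using ch by simp_all
  \<comment> \<open>The value \<open>- u\<close> belongs to the negation of the curve followed by a
    scaling; it will replace \<open>\<alpha>\<close> by \<open>- \<alpha>\<close>.\<close>
  have g: "\<gamma> = 0 \<or> \<gamma> = - u" using e(2) by (simp add: eq_neg_iff_add_eq_0 add.commute)
  have "\<beta> * u * u = 0"
    using g
  proof
    assume "\<gamma> = 0"
    then show ?thesis using e(3,4) by simp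
  next
    assume "\<gamma> = - u"
    then show ?thesis using e(3,4) by auto
  qed
  hence be: "\<beta> = 0" "\<delta> = 0" using u0 e(3) by simp_all
  hence e5: "(\<alpha>^3 * v') * (\<alpha> * u')^3 = v * u^3" using e(5) by simp
  have "u + u = 2 * u" by simp
  hence "\<alpha> * u' = u \<or> \<alpha> * u' = - u" using e(1) g n(3) by auto
  then show ?thesis
  proof
    assume *: "\<alpha> * u' = u"
    hence "\<alpha>^3 * v' = v" using e5 u0 by (simp add: *)
    then show ?thesis unfolding gh_scaled_def using * al by auto
  next
    assume *: "\<alpha> * u' = -u"
    hence "(- \<alpha>)^3 * v' * u^3 = v * u^3" using e5 by algebra
    hence "(- \<alpha>)^3 * v' = v" using u0 by (metis mult_right_cancel power_not_zero)
    moreover have "- \<alpha> * u' = u" using * by simp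
    ultimately show ?thesis unfolding gh_scaled_def using al by (intro exI[of _ "-\<alpha>"]) auto
  qed
qed

text \<open>With t = 2w + 1 and r = \<open>\<alpha> * c'\<close> the hypotheses say U - c = t r and
  t (B - r) = 3c, hence (U - c) (B - r) = 3 c r. This is the link equation up to the factor 9 and
  the scaling by \<open>\<alpha>\<close>.\<close>

lemma linkedI:
  fixes w c r \<alpha> B U u' v' :: "'a::field"
  assumes w: "w^2 + w + 1 = 0" and "\<alpha> \<noteq> 0"
    and r: "(2 * w + 1) * r = U - c" and B: "(2 * w + 1) * B = U + 2 * c"
    and u': "\<alpha> * u' = 3 * B" and v': "\<alpha>^3 * v' = r^3"
  shows "gh_linked (3 * U, c^3) (u', v')"
proof -
  define c' where "c' = r / \<alpha>"
  have c': "\<alpha> * c' = r" using \<open>\<alpha> \<noteq> 0\<close> by (simp add: c'_def)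
  have v: "v' = c'^3" using v' \<open>\<alpha> \<noteq> 0\<close>
      by (simp add: c'_def power_divide field_simps)
  have "\<alpha> * ((3 * U - 3 * c) * (u' - 3 * c')) = 9 * (U - c) * (B - r)"
    using u' c' by algebra
  also have "\<dots> = 9 * r * ((2 * w + 1) * B - (2 * w + 1) * r)" using r by algebra
  also have "\<dots> = 27 * c * r" unfolding B r by algebra
  also have "\<dots> = \<alpha> * (27 * c * c')" unfolding c'[symmetric] by algebra
  finally have "(3 * U - 3 * c) * (u' - 3 * c') = 27 * c * c'"
      using \<open>\<alpha> \<noteq> 0\<close> by (metis mult_left_cancel)
  then show ?thesis using w v unfolding gh_linked_def by auto
qed

text \<open>The first three equations express \<open>B\<close>, \<open>\<beta>\<close> and
  \<open>s\<close> through \<open>g\<close> and \<open>d\<close>; the fourth is then linear in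
  \<open>d\<close> with coefficient \<open>B\<close>, and the last is one remaining condition. For g
  = 0 and g = -U only scalings up to negation arise. For any other g the condition is a norm
  equation, which produces a primitive cube root of unity.\<close>

lemma iso_imp_scaled_or_linked:
  fixes u v u' v' :: "'a::field"
  assumes three: "(3::'a) \<noteq> 0" and u: "u^3 \<noteq> 27 * v"
    and iso: "weier_iso (GH_weier u v) (GH_weier u' v')"
  shows "gh_scaled (u, v) (u', v') \<or> gh_linked (u, v) (u', v')"
proof -
  from iso obtain \<alpha> \<beta> \<gamma> \<delta> where al: "\<alpha> \<noteq> 0"
      and ch: "weier_change \<alpha> \<beta> \<gamma> \<delta> (GH_weier u v) (GH_weier u' v')"
    unfolding weier_iso_def by blast
  \<comment> \<open>After this rescaling all equations have integral coefficients.\<close>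
  define U g d where "U = u / 3" and "g = \<gamma> / 3" and "d = \<delta> / 9"
  have "(9::'a) = 3 * 3" by simp
  hence nine: "(9::'a) \<noteq> 0" using three by (metis mult_eq_0_iff)
  have sub: "u = 3 * U" "\<gamma> = 3 * g" "\<delta> = 9 * d"
      using three nine by (simp_all add: U_def g_def d_def)
  define s where "s = \<alpha>^3 * v'"
  define B where "B = U + 2 * g"
  have c27: "27 * x = 27 * y \<Longrightarrow> x = y" for x y :: 'a
  proof -
    assume "27 * x = 27 * y"
    hence "3 * (9 * (x - y)) = 0" by algebra
    thus "x = y" using three nine by (metis mult_eq_0_iff right_minus_eq)
  qed
  note e = weier_change_GH_weierD[OF ch, folded s_def]
  have au: "\<alpha> * u' = 3 * B" using e(1) unfolding sub B_def by algebra
  have "3 * (\<beta> - 3 * g * (U + g)) = 0" using e(2) unfolding sub by algebra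
  hence be: "\<beta> = 3 * g * (U + g)" using three by (metis mult_eq_0_iff right_minus_eq)
  have "27 * s = 27 * (v - g * U * (U + g) - 2 * d)"
    using e(3) unfolding sub be by algebra
  hence s: "s = v - g * U * (U + g) - 2 * d" by (rule c27)
  have "27 * (d * B) = 27 * (g * v + g^3 * (U + g))"
    using e(4) unfolding sub be B_def by algebra
  hence d: "d * B = g * v + g^3 * (U + g)" by (rule c27)
  have "27 * (s * (B^3 + s)) = 27 * (v * (U^3 + v) - g^3 * (U + g)^3 - 3 * d * v + 3 * d^2 + 3 * g * (U + g) * d * U)"
    using e(5) unfolding au unfolding sub be by algebra
  hence e6: "s * (B^3 + s) = v * (U^3 + v) - g^3 * (U + g)^3 - 3 * d * v + 3 * d^2 + 3 * g * (U + g) * d * U"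
    by (rule c27)
  consider "g = 0" | "g = - U" "g \<noteq> 0" | "B = 0" "g \<noteq> 0" "g \<noteq> - U" | "B \<noteq> 0" "g \<noteq> 0" "g \<noteq> - U" by blast
  then show ?thesis
  proof cases
    case 1
    \<comment> \<open>Here d U = 0 and s = v - 2d. For U = 0 the last equation leaves d = 0 or d =
      v; the second choice gives s = -v, a scaling by \<open>- \<alpha>\<close> because u
      vanishes.\<close>
    have "s = v \<or> s = - v"
    proof (cases "U = 0")
      case True
      have "d * (d - v) = 0" using e6 s 1 True unfolding B_def by algebra
      then show ?thesis using s 1 by auto
    next
      case False
      then show ?thesis using d s 1 by (simp add: B_def)
    qed
    then show ?thesis
    proof
      assume "s = v"
      then show ?thesis using al au 1 unfolding gh_scaled_def s_def B_def sub by auto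
    next
      assume sv: "s = - v"
      show ?thesis
      proof (cases "U = 0")
        case True
        have "u = - \<alpha> * u'" "v = (- \<alpha>)^3 * v'" using sv au 1 True
            unfolding s_def B_def sub by auto
        then show ?thesis using al unfolding gh_scaled_def by (intro disjI1 exI[of _ "-\<alpha>"]) auto
      next
        case False
        hence "s = v" using d s 1 by (simp add: B_def)
        then show ?thesis using al au 1 unfolding gh_scaled_def s_def B_def sub by auto
      qed
    qed
  next
    case 2
    have "g * (d - v) = 0" using d 2(1) unfolding B_def by algebra
    hence "d = v" using 2 by simp
    hence "s = - v" using s 2(1) by simp
    hence "v = (- \<alpha>)^3 * v'" by (simp add: s_def)
    moreover have "u = - \<alpha> * u'" using au 2(1) unfolding B_def sub by algebra
    ultimately show ?thesis using al unfolding gh_scaled_def by (intro disjI1 exI[of _ "-\<alpha>"]) auto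
  next
    case 3
    have U: "U = - 2 * g" using 3 unfolding B_def by algebra
    have "g * (v - g^3) = 0" using d unfolding 3(1) U by algebra
    hence v: "v = g^3" using 3 by simp
    \<comment> \<open>Since B = 0, the linear equation loses \<open>d\<close>, and the last one
      becomes d^2 + g^3 d + 7 g^6 = 0. Its roots are g^3 (3w + 1) with w a primitive cube root of
      unity.\<close>
    define w where "w = (d / g^3 - 1) / 3"
    have "3 * w + 1 = d / g^3" using three by (simp add: w_def del: right_diff_distrib_numeral)
    hence dw: "d = g^3 * (3 * w + 1)" using 3 by simp
    have "s * s = v * (U^3 + v) - g^3 * (U + g)^3 - 3 * d * v + 3 * d^2 + 3 * g * (U + g) * d * U"
      using e6 3(1) by simp
    hence "d^2 + g^3 * d + 7 * g^6 = 0" unfolding s U v by algebra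
    hence "9 * g^6 * (w^2 + w + 1) = 0" unfolding dw by algebra
    hence w: "w^2 + w + 1 = 0" using nine 3 by simp
    have sr: "s = ((2 * w + 1) * g)^3" using w s unfolding U v dw by algebra
    have "gh_linked (3 * U, g^3) (u', v')"
      by (rule linkedI[OF w al _ _ au, of "(2 * w + 1) * g"])
        (use w U 3(1) sr s_def in \<open>simp_all, algebra+\<close>)
    then show ?thesis by (simp add: sub v)
  next
    case 4
    define p q where "p = g^3 + B^3 - 3 * g * B^2" and "q = - 3 * g * (g + U) * B"
    define X where "X = g * v + g^3 * (U + g)"
    define Y where "Y = v * B - g * U * (U + g) * B - 2 * X"
    have X: "d * B = X" using d X_def by simp
    have Y: "s * B = Y" unfolding Y_def s X[symmetric] by algebra
    \<comment> \<open>Eliminating \<open>d\<close> leaves the norm form of \<open>(g + B w)^3 - v = p + q w - v\<close>, whose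
      vanishing with \<open>q \<noteq> 0\<close> produces both \<open>w\<close>
          and the cube root \<open>g + B w\<close> of \<open>v\<close>.\<close>
    have "g * (g + U) * ((p - v)^2 - (p - v) * q + q^2) =
       B^2 * v * (U^3 + v) - B^2 * g^3 * (U + g)^3 - 3 * X * B * v + 3 * X^2 + 3 * g * (U + g) * U * X * B - Y * B^4 - Y^2"
      unfolding p_def q_def Y_def X_def B_def by algebra
    also have "\<dots> = B^2 * (v * (U^3 + v) - g^3 * (U + g)^3 - 3 * d * v + 3 * d^2 + 3 * g * (U + g) * d * U - s * (B^3 + s))"
      unfolding X[symmetric] Y[symmetric] by algebra
    also have "\<dots> = 0" using e6 by algebra
    finally have "g * (g + U) * ((p - v)^2 - (p - v) * q + q^2) = 0" .
    hence N: "(p - v)^2 - (p - v) * q + q^2 = 0" using 4 by (metis mult_eq_0_iff eq_neg_iff_add_eq_0)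
    have q: "q \<noteq> 0" using 4 three by (simp add: p_def q_def eq_neg_iff_add_eq_0)
    define w where "w = (v - p) / q"
    have wq: "w * q = v - p" using q by (simp add: w_def)
    have "q^2 * (w^2 + w + 1) = 0" using N wq by algebra
    hence w: "w^2 + w + 1 = 0" using q by simp
    define c where "c = g + B * w"
    have v: "v = c^3" using wq w unfolding c_def p_def q_def B_def by algebra
    have gc: "g = c - B * w" by (simp add: c_def)
    have U: "U = (2 * w + 1) * B - 2 * c" unfolding c_def B_def by algebra
    define r where "r = (U - c) / (2 * w + 1)"
    have "(2 * w + 1)^2 = -3" using w by algebra
    hence t: "2 * w + 1 \<noteq> 0" using three by auto
    have r: "(2 * w + 1) * r = U - c" using t by (simp add: r_def)
    \<comment> \<open>Once v = c^3 is known, the right side of the linear equation is divisible by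
      B, so d becomes a polynomial in c, B and w.\<close>
    have "g * v + g^3 * (U + g) = g * ((3 * w + 1) * c^2 + (w + 3) * c * B - w * B^2) * B"
      unfolding v gc U using w by algebra
    hence "d * B = g * ((3 * w + 1) * c^2 + (w + 3) * c * B - w * B^2) * B" using d by simp
    hence d': "d = g * ((3 * w + 1) * c^2 + (w + 3) * c * B - w * B^2)" using 4 by simp
    have "(2 * w + 1)^3 * s = (U - c)^3"
      unfolding s d' v gc U using w by algebra
    also have "\<dots> = (2 * w + 1)^3 * r^3" unfolding r[symmetric] by algebra
    finally have "s = r^3" using t by simp
    then have "gh_linked (3 * U, c^3) (u', v')"
      by (intro linkedI[OF w al r _ au]) (simp_all add: U s_def)
    then show ?thesis by (simp add: sub v)
  qed
qed

section \<open>Cubes in finite fields\<close>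

lemma card_eq_mult_card_image:
  assumes "finite A" "\<And>x. x \<in> A \<Longrightarrow> card {y \<in> A. h y = h x} = k"
  shows "card A = k * card (h ` A)"
proof -
  have "card A = (\<Sum>y\<in>h ` A. card {x \<in> A. h x = y})"
    using sum.image_gen[OF assms(1), of "\<lambda>_. 1::nat" h] by simp
  also have "\<dots> = (\<Sum>y\<in>h ` A. k)"
    by (rule sum.cong) (use assms(2) in auto)
  finally show ?thesis by simp
qed

text \<open>Multiplication by x permutes the nonzero elements, so their product does not change when
  multiplied by x^(q-1).\<close>

lemma power_card_minus_one_eq_one:
  fixes x :: "'a::{finite,field}"
  assumes "x \<noteq> 0"
  shows "x ^ (card (UNIV :: 'a set) - 1) = 1"
proof -
  have "(\<Prod>y\<in>UNIV-{0}. x * y) = (\<Prod>y\<in>UNIV-{0}. y)"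
    by (rule prod.reindex_bij_witness[of _ "\<lambda>y. y / x" "\<lambda>y. x * y"]) (use assms in auto)
  hence "x ^ (card (UNIV :: 'a set) - 1) * \<Prod>(UNIV-{0}) = \<Prod>(UNIV-{0})"
    by (simp add: prod.distrib)
  thus ?thesis by simp
qed

text \<open>For q = 3m + 1 the polynomial X^m - 1 has at most m < q - 1 roots, so some nonzero x has
  x^m different from 1, while its cube x^(3m) is 1.\<close>

lemma ex_primitive_cube_root:
  assumes "card (UNIV :: 'a::{finite,field} set) mod 3 = 1"
  shows "\<exists>w::'a. w^2 + w + 1 = 0"
proof -
  let ?q = "card (UNIV :: 'a set)"
  define m where "m = ?q div 3"
  have q: "?q = 3 * m + 1" using assms unfolding m_def by presburger
  have "card {0::'a, 1} \<le> ?q" by (rule card_mono) auto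
  hence m: "m > 0" using q by (cases m) auto
  have "\<exists>x::'a. x \<noteq> 0 \<and> x ^ m \<noteq> 1"
  proof (rule ccontr)
    assume "\<not> ?thesis"
    hence *: "UNIV - {0} \<subseteq> {x::'a. poly (monom 1 m - 1) x = 0}"
      by (auto simp: poly_monom)
    have "degree (monom (1::'a) m - 1) \<le> m"
      by (intro degree_diff_le degree_monom_le) auto
    moreover have "monom (1::'a) m - 1 \<noteq> 0"
    proof
      assume "monom (1::'a) m - 1 = 0"
      hence "poly (monom (1::'a) m - 1) 0 = 0" by simp
      thus False using m by (simp add: poly_monom power_0_left)
    qed
    ultimately have "card {x::'a. poly (monom 1 m - 1) x = 0} \<le> m"
      using card_poly_roots_bound le_trans by blast
    moreover have "?q - 1 \<le> card {x::'a. poly (monom 1 m - 1) x = 0}"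
      using card_mono[OF _ *] by simp
    ultimately show False using q m by simp
  qed
  then obtain x :: 'a where x: "x \<noteq> 0" "x ^ m \<noteq> 1" by blast
  define z where "z = x ^ m"
  have "z^3 = 1" unfolding z_def using power_card_minus_one_eq_one[OF x(1)] unfolding q
    by (simp add: mult.commute flip: power_mult)
  hence "(z - 1) * (z^2 + z + 1) = 0" by algebra
  thus ?thesis using x(2) unfolding z_def[symmetric] by auto
qed

text \<open>In characteristic 3 the map x^3 - x is additive with kernel {0, 1, -1}, so all its
  fibres have three elements.\<close>

lemma card_mod_3_if_char_3:
  assumes "(3::'a::{finite,field}) = 0"
  shows "card (UNIV :: 'a set) mod 3 = 0"
proof -
  have "card {y. y^3 - y = x^3 - x} = 3" for x :: 'a
  proof -
    have "y^3 - y - (x^3 - x) = (y - x) * ((y - (x + 1)) * (y - (x - 1))) + 3 * (x * y * (y - x))" for y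
      by algebra
    hence "y^3 - y - (x^3 - x) = (y - x) * ((y - (x + 1)) * (y - (x - 1)))" for y
      using assms by simp
    hence "y^3 - y = x^3 - x \<longleftrightarrow> y = x \<or> y = x + 1 \<or> y = x - 1" for y
      by (metis mult_eq_0_iff right_minus_eq)
    hence "{y. y^3 - y = x^3 - x} = {x, x + 1, x - 1}" by blast
    moreover have "x + 1 \<noteq> x - 1"
    proof
      assume "x + 1 = x - 1"
      hence "(x + 1) - (x - 1) = 0" by (simp only: diff_self)
      hence "(2::'a) = 0" by simp
      moreover have "(3::'a) = 2 + 1" by simp
      ultimately have "(1::'a) = 0" using assms by simp
      thus False by simp
    qed
    ultimately show ?thesis by simp
  qed
  hence "card (UNIV :: 'a set) = 3 * card (range (\<lambda>x::'a. x^3 - x))"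
    by (intro card_eq_mult_card_image) auto
  thus ?thesis by simp
qed

lemma cube_eq_iff_primitive:
  fixes w x y :: "'a::field"
  assumes w: "w^2 + w + 1 = 0"
  shows "y^3 = x^3 \<longleftrightarrow> y = x \<or> y = w * x \<or> y = w^2 * x"
proof -
  have w2: "w^2 = - 1 - w" using w by algebra
  have "w * (- 1 - w) = 1" using w by algebra
  hence "(y - w * x) * (y - (- 1 - w) * x) = y^2 + x * y + x^2" by algebra
  hence "(y - x) * ((y - w * x) * (y - w^2 * x)) = y^3 - x^3" unfolding w2 by algebra
  thus ?thesis by (metis mult_eq_0_iff right_minus_eq)
qed

text \<open>Cubing is three-to-one on nonzero elements. The sizes of orbits below are found by
  describing them through the cubes of their members.\<close>

lemma card_cube_vimage:
  fixes w :: "'a::{finite,field}"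
  assumes w: "w^2 + w + 1 = 0" and three: "(3::'a) \<noteq> 0"
    and B: "\<And>b. b \<in> B \<Longrightarrow> \<exists>x. x \<noteq> 0 \<and> b = x^3"
  shows "card {y::'a. y^3 \<in> B} = 3 * card B"
proof -
  let ?A = "{y::'a. y^3 \<in> B}"
  have w0: "w \<noteq> 0" using w by auto
  have w1: "w \<noteq> 1"
  proof
    assume "w = 1"
    hence "(3::'a) = 0" using w by simp
    thus False using three by simp
  qed
  have w2: "w^2 \<noteq> w" using w0 w1 by (simp add: power2_eq_square)
  have w21: "w^2 \<noteq> 1"
  proof
    assume "w^2 = 1"
    hence "w * w^2 = w" by simp
    moreover have "w * w^2 = 1" using w by algebra
    ultimately show False using w1 by simp
  qed
  have "card {y \<in> ?A. y^3 = x^3} = 3" if x: "x \<in> ?A" for x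
  proof -
    have x0: "x \<noteq> 0" using B[of "x^3"] x by auto
    have "{y \<in> ?A. y^3 = x^3} = {y. y^3 = x^3}" using x by auto
    also have "\<dots> = {x, w * x, w^2 * x}" using cube_eq_iff_primitive[OF w] by auto
    also have "card \<dots> = 3" using x0 w0 w1 w2 w21 by simp
    finally show ?thesis .
  qed
  hence "card ?A = 3 * card ((\<lambda>y. y^3) ` ?A)" by (intro card_eq_mult_card_image) auto
  moreover have "(\<lambda>y. y^3) ` ?A = B" using B by blast
  ultimately show ?thesis by simp
qed

section \<open>Counting scaling classes\<close>

lemma gh_scaled_refl: "gh_scaled p p"
  unfolding gh_scaled_def by (intro exI[of _ 1]) simp

lemma gh_scaled_sym: "gh_scaled p p' \<Longrightarrow> gh_scaled p' p"
  unfolding gh_scaled_def by (elim exE, rule_tac x = "1 / l" in exI) (simp add: power_one_over)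

lemma gh_linked_sym:
  fixes p p' :: "'a::field \<times> 'a"
  assumes "gh_linked p p'"
  shows "gh_linked p' p"
proof -
  from assms obtain w c c' :: 'a where "w^2 + w + 1 = 0" "snd p = c^3" "snd p' = c'^3"
    and L: "(fst p - 3 * c) * (fst p' - 3 * c') = 27 * c * c'"
    unfolding gh_linked_def by blast
  moreover have "(fst p' - 3 * c') * (fst p - 3 * c) = 27 * c' * c" using L by algebra
  ultimately show ?thesis unfolding gh_linked_def by blast
qed

lemma GH_iso_rel_iff:
  assumes "p \<in> GH_params" "p' \<in> GH_params"
  shows "(p, p') \<in> GH_iso_rel \<longleftrightarrow> gh_scaled p p' \<or> (3::'a::field) \<noteq> 0 \<and> gh_linked p (p' :: 'a \<times> 'a)"
proof -
  obtain u v u' v' where p: "p = (u, v)" "p' = (u', v')" by fastforce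
  have "v \<noteq> 0" "u^3 \<noteq> 27 * v" "v' \<noteq> 0"
    using assms by (auto simp: p GH_params_def)
  hence "weier_iso (GH_weier u v) (GH_weier u' v') \<longleftrightarrow>
      gh_scaled (u, v) (u', v') \<or> (3::'a) \<noteq> 0 \<and> gh_linked (u, v) (u', v')"
    using iso_imp_scaled_char3 iso_imp_scaled_or_linked scaled_imp_iso linked_imp_iso by metis
  thus ?thesis using assms by (simp add: p GH_iso_rel_def)
qed

text \<open>Symmetry is visible in the criterion by scaling and linking, whereas transitivity is
  taken from the composition of substitutions.\<close>

lemma equiv_GH_iso_rel: "equiv GH_params (GH_iso_rel :: (('a::field \<times> 'a) \<times> ('a \<times> 'a)) set)"
proof (rule equivI)
  show sub: "(GH_iso_rel :: (('a \<times> 'a) \<times> ('a \<times> 'a)) set) \<subseteq> GH_params \<times> GH_params"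
    by (auto simp: GH_iso_rel_def)
  show "refl_on GH_params (GH_iso_rel :: (('a \<times> 'a) \<times> ('a \<times> 'a)) set)"
    unfolding refl_on_def using GH_iso_rel_iff gh_scaled_refl by blast
  show "sym (GH_iso_rel :: (('a \<times> 'a) \<times> ('a \<times> 'a)) set)"
    unfolding sym_def using sub GH_iso_rel_iff gh_scaled_sym gh_linked_sym by blast
  show "trans (GH_iso_rel :: (('a \<times> 'a) \<times> ('a \<times> 'a)) set)"
    unfolding trans_def GH_iso_rel_def using weier_iso_trans by blast
qed

section \<open>Classes and systems of representatives\<close>

definition gh_class :: "'a::field \<times> 'a \<Rightarrow> ('a \<times> 'a) set" where
  "gh_class p = GH_iso_rel `` {p}"

lemma gh_class_eq_iff:
  fixes p p' :: "'a::field \<times> 'a"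
  assumes "p \<in> GH_params" "p' \<in> GH_params"
  shows "gh_class p = gh_class p' \<longleftrightarrow> gh_scaled p p' \<or> (3::'a) \<noteq> 0 \<and> gh_linked p p'"
  unfolding gh_class_def eq_equiv_class_iff[OF equiv_GH_iso_rel assms] by (rule GH_iso_rel_iff[OF assms])

lemma gh_class_eqI: "p \<in> GH_params \<Longrightarrow> p' \<in> GH_params \<Longrightarrow> gh_scaled p p' \<Longrightarrow> gh_class p = gh_class p'"
  by (simp add: gh_class_eq_iff)

text \<open>Reduces the count to normal forms under scaling. Several members of \<open>D\<close> may
  still share a class through linking, hence the image on the right.\<close>

lemma I_GH_eq_card_image:
  fixes D :: "('a::{finite,field} \<times> 'a) set"
  assumes "D \<subseteq> GH_params" "\<And>p. p \<in> GH_params \<Longrightarrow> \<exists>p'\<in>D. gh_scaled p p'"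
  shows "I_GH TYPE('a) = card (gh_class ` D)"
proof -
  have "(GH_params :: ('a \<times> 'a) set) // GH_iso_rel = gh_class ` GH_params"
    by (auto simp: quotient_def gh_class_def)
  moreover have "gh_class ` GH_params = gh_class ` D"
  proof
    show "gh_class ` GH_params \<subseteq> gh_class ` D"
    proof (rule image_subsetI)
      fix p :: "'a \<times> 'a" assume p: "p \<in> GH_params"
      then obtain p' where "p' \<in> D" "gh_scaled p p'" using assms(2) by blast
      then show "gh_class p \<in> gh_class ` D" using gh_class_eqI[OF p] assms(1) by blast
    qed
  qed (use assms(1) in auto)
  ultimately show ?thesis by (simp add: I_GH_def)
qed

section \<open>Fields where only scalings occur\<close>

lemma I_GH_char_3:
  assumes three: "(3::'a::{finite,field}) = 0"
  shows "I_GH TYPE('a) = card (UNIV :: 'a set) - 1"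
proof -
  \<comment> \<open>As 27 = 0, nonsingularity requires u to be nonzero, so scaling makes u = 1 and
    leaves v as a complete invariant.\<close>
  define D where "D = Pair (1::'a) ` (UNIV - {0::'a})"
  have "(27::'a) = 9 * 3" by simp
  hence n: "(27::'a) = 0" unfolding three by simp
  have D: "D \<subseteq> GH_params" by (simp add: D_def GH_params_def n image_subset_iff)
  have "I_GH TYPE('a) = card (gh_class ` D)"
  proof (rule I_GH_eq_card_image[OF D])
    fix p :: "'a \<times> 'a" assume p: "p \<in> GH_params"
    obtain u v where uv: "p = (u, v)" by fastforce
    have "u \<noteq> 0" "v \<noteq> 0" using p by (simp_all add: uv GH_params_def n)
    hence "(1, v / u^3) \<in> D" "gh_scaled p (1, v / u^3)"
      by (simp_all add: D_def gh_scaled_def uv exI[of _ u])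
    thus "\<exists>p'\<in>D. gh_scaled p p'" by blast
  qed
  also have "\<dots> = card D"
  proof (rule card_image, rule inj_onI)
    fix p p' assume pp: "p \<in> D" "p' \<in> D" "gh_class p = gh_class p'"
    hence "gh_scaled p p'" using gh_class_eq_iff[of p p'] three D by auto
    thus "p = p'" using pp(1,2) by (auto simp: D_def gh_scaled_def)
  qed
  also have "\<dots> = card (UNIV :: 'a set) - 1"
    unfolding D_def by (subst card_image) (auto simp: inj_on_def)
  finally show ?thesis .
qed

lemma I_GH_no_cube_root:
  assumes three: "(3::'a::{finite,field}) \<noteq> 0" and w: "\<nexists>w::'a. w^2 + w + 1 = 0"
  shows "I_GH TYPE('a) = card (UNIV :: 'a set) - 1"
proof -
  have inj: "x = y" if "x^3 = y^3" for x y :: 'a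
  proof (rule ccontr)
    assume "x \<noteq> y"
    have "(x - y) * (x^2 + x * y + y^2) = 0" using that by algebra
    hence *: "x^2 + x * y + y^2 = 0" using \<open>x \<noteq> y\<close> by simp
    hence "y \<noteq> 0" using \<open>x \<noteq> y\<close> by auto
    hence "(x / y)^2 + x / y + 1 = (x^2 + x * y + y^2) / y^2"
      by (simp add: field_simps power2_eq_square)
    thus False using w * by auto
  qed
  have "surj (\<lambda>x::'a. x^3)"
    by (intro finite_UNIV_inj_surj injI) (simp_all add: inj)
  hence surj: "\<exists>x. v = x^3" for v :: 'a by (rule surjD)
  \<comment> \<open>Every v is a cube, so scaling makes v = 1. Only 1 has cube 1, so u is then an
    invariant; u = 3 is the singular value.\<close>
  define D where "D = (\<lambda>x::'a. (x, 1::'a)) ` (UNIV - {3})"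
  have "x^3 \<noteq> 27" if "x \<noteq> 3" for x :: 'a using inj[of x 3] that by auto
  hence D: "D \<subseteq> GH_params" by (simp add: D_def GH_params_def image_subset_iff)
  have "I_GH TYPE('a) = card (gh_class ` D)"
  proof (rule I_GH_eq_card_image[OF D])
    fix p :: "'a \<times> 'a" assume p: "p \<in> GH_params"
    obtain u v where uv: "p = (u, v)" by fastforce
    obtain c where c: "v = c^3" using surj by blast
    have cu: "c \<noteq> 0" "u \<noteq> 3 * c" using p by (auto simp: uv c GH_params_def power_mult_distrib)
    have "(u / c, 1) \<in> D" unfolding D_def using cu by (intro imageI) (simp add: divide_eq_eq)
    moreover have "gh_scaled p (u / c, 1)" using cu(1)
      by (simp add: gh_scaled_def uv c exI[of _ c])
    ultimately have "(u / c, 1) \<in> D" "gh_scaled p (u / c, 1)" by blast+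
    thus "\<exists>p'\<in>D. gh_scaled p p'" by blast
  qed
  also have "\<dots> = card D"
  proof (rule card_image, rule inj_onI)
    fix p p' assume pp: "p \<in> D" "p' \<in> D" "gh_class p = gh_class p'"
    hence "gh_scaled p p'" using gh_class_eq_iff[of p p'] w D by (auto simp: gh_linked_def)
    thus "p = p'" using pp(1,2) inj[of _ 1] by (auto simp: D_def gh_scaled_def)
  qed
  also have "\<dots> = card (UNIV :: 'a set) - 1"
    unfolding D_def by (subst card_image) (auto simp: inj_on_def)
  finally show ?thesis .
qed

section \<open>Orbits of the Hessian parameter\<close>

text \<open>For the curve with parameters \<open>(x, 1)\<close>, the Weierstrass invariants are \<open>c4 = hess_c4 x\<close> and
  \<open>c6 = - hess_c6 x\<close>.\<close>

definition hess_c4 :: "'a::field \<Rightarrow> 'a" where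
  "hess_c4 x = x * (x^3 + 216)"

definition hess_c6 :: "'a::field \<Rightarrow> 'a" where
  "hess_c6 x = x^6 - 540 * x^3 - 5832"

lemma numeral_ne_zero_of_three:
  assumes "(3::'a::field) \<noteq> 0"
  shows "(9::'a) \<noteq> 0" "(27::'a) \<noteq> 0" "(729::'a) \<noteq> 0" "(19683::'a) \<noteq> 0" "(243::'a) \<noteq> 0"
proof -
  have e: "(9::'a) = 3 * 3" "(27::'a) = 9 * 3" "(729::'a) = 27 * 27" "(19683::'a) = 729 * 27" "(243::'a) = 27 * 9"
    by simp_all
  show 9: "(9::'a) \<noteq> 0" unfolding e(1) using assms by (metis mult_eq_0_iff)
  show 27: "(27::'a) \<noteq> 0" unfolding e(2) using assms 9 by (metis mult_eq_0_iff)
  show 729: "(729::'a) \<noteq> 0" unfolding e(3) using 27 by (metis mult_eq_0_iff)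
  show "(19683::'a) \<noteq> 0" unfolding e(4) using 27 729 by (metis mult_eq_0_iff)
  show "(243::'a) \<noteq> 0" unfolding e(5) using 9 27 by (metis mult_eq_0_iff)
qed

lemma hess_cube_cong:
  fixes x y :: "'a::field"
  assumes "x^3 = y^3"
  shows "hess_c4 x = 0 \<longleftrightarrow> hess_c4 y = 0" "hess_c6 x = hess_c6 y"
proof -
  have "x = 0 \<longleftrightarrow> y = 0" using assms power_eq_0_iff[of x 3] power_eq_0_iff[of y 3] by simp
  thus "hess_c4 x = 0 \<longleftrightarrow> hess_c4 y = 0" by (simp add: hess_c4_def assms)
  have "z^6 = (z^3)^2" for z :: 'a by simp
  thus "hess_c6 x = hess_c6 y" by (simp only: hess_c6_def assms)
qed

lemma hess_tau_times:
  fixes z a :: "'a::field"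
  assumes "(z - 3) * (a - 3) = 27"
  shows "a * (z - 3) = 3 * (z + 6)"
proof -
  have "a * (z - 3) = (z - 3) * (a - 3) + 3 * (z - 3)" by algebra
  thus ?thesis unfolding assms by algebra
qed

text \<open>With d = z - 3, the involution multiplies z^3 - 27 and \<open>hess_c4 z\<close> by 729 /
  d^4 and \<open>hess_c6 z\<close> by -19683 / d^6. These factors are powers of 3 up to sign over
  powers of d, hence nonzero.\<close>

lemma hess_tau_inv:
  fixes z z' :: "'a::field"
  assumes three: "(3::'a) \<noteq> 0" and zz: "(z - 3) * (z' - 3) = 27"
  shows "z'^3 = 27 \<longleftrightarrow> z^3 = 27" "hess_c4 z' = 0 \<longleftrightarrow> hess_c4 z = 0" "hess_c6 z' = 0 \<longleftrightarrow> hess_c6 z = 0"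
proof -
  note n = numeral_ne_zero_of_three[OF three]
  have z3: "z - 3 \<noteq> 0" using zz n by auto
  define d where "d = z - 3"
  have z: "z = d + 3" by (simp add: d_def)
  define e where "e = z' * d"
  have e: "e = 3 * d + 27" using hess_tau_times[OF zz] unfolding e_def d_def by algebra
  have "(z'^3 - 27) * d^4 = d * (e^3 - 27 * d^3)" unfolding e_def by algebra
  also have "\<dots> = 729 * (z^3 - 27)" unfolding e z by algebra
  finally show "z'^3 = 27 \<longleftrightarrow> z^3 = 27" using z3 n unfolding d_def[symmetric]
    by (metis mult_eq_0_iff power_eq_0_iff right_minus_eq)
  have "hess_c4 z' * d^4 = e * (e^3 + 216 * d^3)" unfolding e_def hess_c4_def by algebra
  also have "\<dots> = 729 * hess_c4 z" unfolding e z hess_c4_def by algebra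
  finally show "hess_c4 z' = 0 \<longleftrightarrow> hess_c4 z = 0" using z3 n unfolding d_def[symmetric]
    by (metis mult_eq_0_iff power_eq_0_iff)
  have "hess_c6 z' * d^6 = e^6 - 540 * e^3 * d^3 - 5832 * d^6" unfolding e_def hess_c6_def by algebra
  also have "\<dots> = - (19683 * hess_c6 z)" unfolding e z hess_c6_def by algebra
  finally have "hess_c6 z' * d^6 = - (19683 * hess_c6 z)" .
  moreover have "d \<noteq> 0" using z3 by (simp only: d_def not_False_eq_True)
  ultimately show "hess_c6 z' = 0 \<longleftrightarrow> hess_c6 z = 0" using n(4)
    by (cases "hess_c6 z = 0") auto
qed

text \<open>For k = 1 the quadratic is (z - 3)^2 = 27, the equation for fixed points of the
  involution; in general its roots are k times those fixed points.\<close>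

lemma hess_c6_factor:
  fixes k z :: "'a::field"
  assumes k: "k^3 = 1" and "z^2 - 6 * k * z - 18 * k^2 = 0"
  shows "hess_c6 z = 0"
proof -
  have "z^6 - 540 * z^3 * k^3 - 5832 * (k^3)^2 = (z^2 - 6 * k * z - 18 * k^2) *
     (z^4 + 6 * k * z^3 + 54 * k^2 * z^2 - 108 * k^3 * z + 324 * k^4)"
    by algebra
  thus ?thesis using assms by (simp add: hess_c6_def)
qed

lemma hess_tau_cube_ne:
  fixes z a :: "'a::field"
  assumes gen: "hess_c4 z \<noteq> 0" "hess_c6 z \<noteq> 0" "z^3 \<noteq> 27"
      and za: "(z - 3) * (a - 3) = 27"
  shows "a^3 \<noteq> z^3"
proof
  assume *: "a^3 = z^3"
  define d where "d = z - 3"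
  have z: "z = d + 3" by (simp add: d_def)
  define e where "e = a * d"
  have e: "e = 3 * d + 27" using hess_tau_times[OF za] unfolding e_def d_def by algebra
  have "0 = (a^3 - z^3) * d^4 * (z + 6)" using * by simp
  \<comment> \<open>e^3 - z^3 d^3 contains the factors z^2 - 6z + 36 and z^2 + 3z + 9; multiplying
    by z + 6 and d completes them to z^3 + 216 and z^3 - 27.\<close>
  also have "\<dots> = (e^3 - z^3 * d^3) * d * (z + 6)" unfolding e_def by algebra
  also have "\<dots> = (18 + 6 * z - z^2) * (z^3 + 216) * (z^3 - 27)" unfolding e z by algebra
  finally have "(18 + 6 * z - z^2) * (z^3 + 216) * (z^3 - 27) = 0" by (rule sym)
  hence "18 + 6 * z - z^2 = 0" using gen by (auto simp: hess_c4_def)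
  hence "z^2 - 6 * z - 18 = 0" by algebra
  thus False using hess_c6_factor[of 1 z] gen by simp
qed

text \<open>Equal cubes mean that a is b times 1, k or k^2. Each case is an algebraic equation for
  z: it forces z = 0, then z = -6k or z = 3k, then a twisted fixed point equation. All of these are
  excluded for generic z.\<close>

lemma hess_tau_cube_ne2:
  fixes z a b k :: "'a::field"
  assumes three: "(3::'a) \<noteq> 0" and k: "k^2 + k + 1 = 0"
    and gen: "hess_c4 z \<noteq> 0" "hess_c6 z \<noteq> 0" "z^3 \<noteq> 27"
    and a: "(z - 3) * (a - 3) = 27" and b: "(k * z - 3) * (b - 3) = 27"
  shows "a^3 \<noteq> b^3"
proof
  assume "a^3 = b^3"
  note n = numeral_ne_zero_of_three[OF three]
  have k3: "k^3 = 1" using k by algebra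
  have k1: "k - 1 \<noteq> 0"
  proof
    assume "k - 1 = 0"
    hence "(3::'a) = 0" using k by simp
    thus False using three by simp
  qed
  have k0: "k \<noteq> 0" using k by auto
  have z0: "z \<noteq> 0" using gen(1) by (auto simp: hess_c4_def)
  define d where "d = z - 3"
  define d' where "d' = k * z - 3"
  have ad: "a * d = 3 * (z + 6)" using hess_tau_times[OF a] unfolding d_def .
  have bd: "b * d' = 3 * (k * z + 6)" using hess_tau_times[OF b] unfolding d'_def .
  consider "a = b" | "a = k * b" | "a = k^2 * b"
    using cube_eq_iff_primitive[OF k] \<open>a^3 = b^3\<close> by blast
  thus False
  proof cases
    case 1
    have "a - 3 \<noteq> 0" using a n by auto
    moreover have "(z - 3) * (a - 3) = (k * z - 3) * (a - 3)" using a b 1 by simp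
    ultimately have "z - 3 = k * z - 3" by (metis mult_right_cancel)
    hence "(k - 1) * z = 0" by algebra
    thus False using k1 z0 by simp
  next
    case 2
    have "3 * (z + 6) * d' = k * (b * d') * d" unfolding ad[symmetric] 2 by algebra
    hence "3 * ((z + 6) * d' - k * (k * z + 6) * d) = 0" unfolding bd by algebra
    moreover have "(z + 6) * d' - k * (k * z + 6) * d = - (k - 1) * k * ((z + 6 * k) * (z - 3 * k))"
      unfolding d_def d'_def using k by algebra
    ultimately have "(z + 6 * k) * (z - 3 * k) = 0" using three k1 k0 by auto
    hence "z = - 6 * k \<or> z = 3 * k" by (simp add: eq_neg_iff_add_eq_0)
    thus False using gen k3 by (auto simp: hess_c4_def power_mult_distrib)
  next
    case 3
    have "3 * (z + 6) * d' = k^2 * (b * d') * d" unfolding ad[symmetric] 3 by algebra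
    hence "3 * ((z + 6) * d' - k^2 * (k * z + 6) * d) = 0" unfolding bd by algebra
    moreover have "(z + 6) * d' - k^2 * (k * z + 6) * d = (k - 1) * (z^2 - 6 * k * z - 18 * k^2)"
      unfolding d_def d'_def using k by algebra
    ultimately have "z^2 - 6 * k * z - 18 * k^2 = 0" using three k1 by (metis mult_eq_0_iff)
    thus False using hess_c6_factor[OF k3] gen by blast
  qed
qed

section \<open>Classes of the curves with v = 1\<close>

definition hess_class :: "'a::field \<Rightarrow> ('a \<times> 'a) set" where
  "hess_class x = gh_class (x, 1)"

lemma hess_params: "(x, 1) \<in> GH_params \<longleftrightarrow> x^3 \<noteq> (27 :: 'a::field)"
  by (simp add: GH_params_def)

lemma cube_eq_imp_unit:
  fixes x z :: "'a::field"
  assumes "z^3 = x^3"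
  obtains c where "c^3 = 1" "x = c * z"
proof (cases "z = 0")
  case True
  hence "x = 0" using assms power_eq_0_iff[of x 3] by simp
  thus ?thesis using that[of 1] True by simp
next
  case False
  hence "x \<noteq> 0" using assms power_eq_0_iff[of z 3] by auto
  thus ?thesis using False that[of "x / z"] assms by (simp add: power_divide)
qed

text \<open>The cube roots of unity c and c' in the linking relation are absorbed by passing to x /
  c and y / c', which have the same cubes as x and y.\<close>

lemma hess_class_eq_iff:
  fixes w x y :: "'a::field"
  assumes w: "w^2 + w + 1 = 0" and three: "(3::'a) \<noteq> 0" and x: "x^3 \<noteq> 27"
      and y: "y^3 \<noteq> 27"
  shows "hess_class x = hess_class y \<longleftrightarrow>
    x^3 = y^3 \<or> (\<exists>z z'. z^3 = x^3 \<and> z'^3 = y^3 \<and> (z - 3) * (z' - 3) = 27)" (is "_ \<longleftrightarrow> ?R")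
proof -
  have "gh_scaled (x, 1) (y, 1) \<or> gh_linked (x, 1) (y, 1) \<longleftrightarrow> ?R"
  proof
    assume "gh_scaled (x, 1) (y, 1) \<or> gh_linked (x, 1) (y, 1)"
    thus ?R
    proof
      assume "gh_scaled (x, 1) (y, 1)"
      then obtain l where "x = l * y" "1 = l^3" by (auto simp: gh_scaled_def)
      thus ?R by (simp add: power_mult_distrib)
    next
      assume "gh_linked (x, 1) (y, 1)"
      then obtain c c' where c: "c^3 = 1" "c'^3 = 1" and L: "(x - 3 * c) * (y - 3 * c') = 27 * c * c'"
        by (auto simp: gh_linked_def)
      have c0: "c \<noteq> 0" "c' \<noteq> 0" using c by auto
      have "x / c - 3 = (x - 3 * c) / c" "y / c' - 3 = (y - 3 * c') / c'"
        using c0 by (simp_all add: diff_divide_distrib)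
      hence "(x / c - 3) * (y / c' - 3) = ((x - 3 * c) * (y - 3 * c')) / (c * c')" by simp
      also have "\<dots> = 27" unfolding L using c0 by simp
      finally show ?R using c by (intro disjI2 exI[of _ "x / c"] exI[of _ "y / c'"]) (simp add: power_divide)
    qed
  next
    assume ?R
    thus "gh_scaled (x, 1) (y, 1) \<or> gh_linked (x, 1) (y, 1)"
    proof (elim disjE exE conjE)
      assume "x^3 = y^3"
      then obtain c where c: "c^3 = 1" "x = c * y" using cube_eq_imp_unit[of y x] by metis
      hence "c \<noteq> 0" by auto
      hence "gh_scaled (x, 1) (y, 1)" unfolding gh_scaled_def using c by (intro exI[of _ c]) simp
      thus ?thesis ..
    next
      fix z z' assume z: "z^3 = x^3" "z'^3 = y^3" and zz: "(z - 3) * (z' - 3) = 27"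
      obtain c where c: "c^3 = 1" "x = c * z" using cube_eq_imp_unit z by metis
      obtain c' where c': "c'^3 = 1" "y = c' * z'" using cube_eq_imp_unit z by metis
      have "(x - 3 * c) * (y - 3 * c') = ((z - 3) * (z' - 3)) * c * c'" unfolding c(2) c'(2) by algebra
      hence "gh_linked (x, 1) (y, 1)" unfolding zz gh_linked_def using w c c'
        by (intro exI[of _ w] exI[of _ c] exI[of _ c']) simp
      thus ?thesis ..
    qed
  qed
  thus ?thesis unfolding hess_class_def
    using gh_class_eq_iff[of "(x, 1)" "(y, 1)"] x y three by (simp add: hess_params)
qed

lemma hess_class_eqD:
  fixes w x y :: "'a::field"
  assumes w: "w^2 + w + 1 = 0" and three: "(3::'a) \<noteq> 0" and x: "x^3 \<noteq> 27"
      and y: "y^3 \<noteq> 27"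
    and eq: "hess_class x = hess_class y"
  shows "hess_c4 x = 0 \<longleftrightarrow> hess_c4 y = 0" "hess_c6 x = 0 \<longleftrightarrow> hess_c6 y = 0"
proof -
  have "x^3 = y^3 \<or> (\<exists>z z'. z^3 = x^3 \<and> z'^3 = y^3 \<and> (z - 3) * (z' - 3) = 27)"
    using hess_class_eq_iff[OF w three x y] eq by simp
  hence "(hess_c4 x = 0 \<longleftrightarrow> hess_c4 y = 0) \<and> (hess_c6 x = 0 \<longleftrightarrow> hess_c6 y = 0)"
  proof (elim disjE exE conjE)
    assume "x^3 = y^3"
    thus ?thesis using hess_cube_cong by metis
  next
    fix z z' assume z: "z^3 = x^3" "z'^3 = y^3" and zz: "(z - 3) * (z' - 3) = 27"
    show ?thesis using hess_tau_inv(2,3)[OF three zz] hess_cube_cong[OF z(1)] hess_cube_cong[OF z(2)] by simp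
  qed
  thus "hess_c4 x = 0 \<longleftrightarrow> hess_c4 y = 0" "hess_c6 x = 0 \<longleftrightarrow> hess_c6 y = 0" by auto
qed

text \<open>The class consists of all y whose cube lies in \<open>B\<close>, that is, equals x^3 or
  the cube of one of the three images of w^i x under the involution. For generic x these four cubes
  are distinct and nonzero, and each has three cube roots.\<close>

lemma card_generic_hess_class:
  fixes w x :: "'a::{finite,field}"
  assumes w: "w^2 + w + 1 = 0" and three: "(3::'a) \<noteq> 0"
    and gen: "hess_c4 x \<noteq> 0" "hess_c6 x \<noteq> 0" "x^3 \<noteq> 27"
  shows "card {y. y^3 \<noteq> 27 \<and> hess_class y = hess_class x} = 12"
proof -
  define t where "t z = 3 + 27 / (z - 3)" for z :: 'a
  note n = numeral_ne_zero_of_three[OF three]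
  have w3: "w^3 = 1" using w by algebra
  hence w23: "(w^2)^3 = 1" by algebra
  have w0: "w \<noteq> 0" using w3 by auto
  have t_iff: "(z - 3) * (a - 3) = 27 \<longleftrightarrow> a = t z" if "z^3 = x^3" for z a
  proof -
    have "z \<noteq> 3" using that gen(3) by auto
    thus ?thesis by (auto simp: t_def field_simps)
  qed
  let ?Z = "{x, w * x, w^2 * x}"
  have Z: "z^3 = x^3 \<longleftrightarrow> z \<in> ?Z" for z
    using cube_eq_iff_primitive[OF w] by auto
  have genz: "hess_c4 z \<noteq> 0" "hess_c6 z \<noteq> 0" "z^3 \<noteq> 27" if "z^3 = x^3" for z
    using hess_cube_cong[OF that] gen that by auto
  define B where "B = insert (x^3) ((\<lambda>z. (t z)^3) ` ?Z)"
  have t_ok: "hess_c4 (t z) \<noteq> 0" "(t z)^3 \<noteq> 27" if "z^3 = x^3" for z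
    using hess_tau_inv[OF three, of z "t z"] t_iff[OF that] genz[OF that] by auto
  have "y^3 \<noteq> 27 \<and> hess_class y = hess_class x \<longleftrightarrow> y^3 \<in> B" for y
  proof
    assume y: "y^3 \<noteq> 27 \<and> hess_class y = hess_class x"
    hence "y^3 = x^3 \<or> (\<exists>z z'. z^3 = x^3 \<and> z'^3 = y^3 \<and> (z - 3) * (z' - 3) = 27)"
      using hess_class_eq_iff[OF w three gen(3), of y] by auto
    thus "y^3 \<in> B"
    proof (elim disjE exE conjE)
      assume "y^3 = x^3" thus ?thesis by (simp add: B_def)
    next
      fix z z' assume z: "z^3 = x^3" "z'^3 = y^3" "(z - 3) * (z' - 3) = 27"
      have "z' = t z" using z t_iff by blast
      hence "y^3 = (t z)^3" using z(2) by simp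
      thus ?thesis unfolding B_def using z(1) Z by blast
    qed
  next
    assume "y^3 \<in> B"
    then consider "y^3 = x^3" | z where "z^3 = x^3" "y^3 = (t z)^3" unfolding B_def using Z by blast
    thus "y^3 \<noteq> 27 \<and> hess_class y = hess_class x"
    proof cases
      case 1
      thus ?thesis using hess_class_eq_iff[OF w three _ gen(3), of y] gen(3) by simp
    next
      case 2
      hence y: "y^3 \<noteq> 27" using t_ok by simp
      have "(z - 3) * (t z - 3) = 27" using t_iff 2 by blast
      hence "hess_class x = hess_class y"
        using hess_class_eq_iff[OF w three gen(3) y] 2 by metis
      thus ?thesis using y by simp
    qed
  qed
  hence "card {y. y^3 \<noteq> 27 \<and> hess_class y = hess_class x} = card {y. y^3 \<in> B}" by simp
  also have "\<dots> = 3 * card B"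
  proof (rule card_cube_vimage[OF w three])
    fix b assume "b \<in> B"
    then consider "b = x^3" | z where "z^3 = x^3" "b = (t z)^3" unfolding B_def using Z by blast
    thus "\<exists>x. x \<noteq> 0 \<and> b = x^3"
    proof cases
      case 1
      have "x \<noteq> 0" using gen(1) by (auto simp: hess_c4_def)
      thus ?thesis using 1 by blast
    next
      case 2
      have "t z \<noteq> 0" using t_ok(1)[OF 2(1)] by (auto simp: hess_c4_def)
      thus ?thesis using 2 by blast
    qed
  qed
  also have "card B = 4"
  proof -
    have c: "(w * x)^3 = x^3" "(w^2 * x)^3 = x^3" using w3 w23 by (simp_all add: power_mult_distrib)
    have 1: "(t z)^3 \<noteq> x^3" if "z^3 = x^3" for z
      using hess_tau_cube_ne[OF genz[OF that], of "t z"] t_iff[OF that] that by simp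
    have 2: "(t z)^3 \<noteq> (t (k * z))^3" if "z^3 = x^3" "k^2 + k + 1 = 0" for z k
    proof -
      have "k^3 = 1" using that(2) by algebra
      hence "(k * z)^3 = x^3" using that(1) by (simp add: power_mult_distrib)
      thus ?thesis
        using hess_tau_cube_ne2[OF three that(2) genz[OF that(1)], of "t z" "t (k * z)"] t_iff that(1) by simp
    qed
    have "(w^2)^2 + w^2 + 1 = 0" using w by algebra
    hence "(t x)^3 \<noteq> (t (w * x))^3" "(t x)^3 \<noteq> (t (w^2 * x))^3" "(t (w * x))^3 \<noteq> (t (w^2 * x))^3"
      using 2[of x w] 2[of x "w^2"] 2[of "w * x" w] c w by (simp_all add: power2_eq_square mult.assoc)
    thus ?thesis using 1[of x] 1[of "w * x"] 1[of "w^2 * x"] c unfolding B_def by simp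
  qed
  finally show ?thesis by simp
qed

section \<open>The exceptional orbits\<close>

lemma hess_c4_zero_iff: "hess_c4 x = 0 \<longleftrightarrow> x = 0 \<or> x^3 = (- 6 :: 'a::field)^3"
  by (auto simp: hess_c4_def eq_neg_iff_add_eq_0)

text \<open>The involution exchanges 0 and -6, since (-9)(-3) = 27, and the remaining zeros have the
  same cube as -6.\<close>

lemma hess_c4_class:
  fixes w :: "'a::{finite,field}"
  assumes w: "w^2 + w + 1 = 0" and three: "(3::'a) \<noteq> 0"
  shows "card (hess_class ` {x::'a. x^3 \<noteq> 27 \<and> hess_c4 x = 0}) = 1"
proof -
  note n = numeral_ne_zero_of_three[OF three]
  have "hess_class x = hess_class 0" if "x^3 \<noteq> 27" "hess_c4 x = 0" for x :: 'a
  proof -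
    have z: "(0::'a)^3 \<noteq> 27" using n by simp
    have "x = 0 \<or> x^3 = (- 6)^3" using that(2) hess_c4_zero_iff by blast
    moreover have "((- 6) - 3) * (0 - 3) = (27 :: 'a)" by simp
    ultimately show ?thesis using hess_class_eq_iff[OF w three that(1) z] by metis
  qed
  moreover have "(0::'a)^3 \<noteq> 27" "hess_c4 (0::'a) = 0" using n by (simp_all add: hess_c4_def)
  ultimately have "hess_class ` {x::'a. x^3 \<noteq> 27 \<and> hess_c4 x = 0} = {hess_class 0}" by blast
  thus ?thesis by simp
qed

text \<open>The zeros are 0 and the three cube roots of (-6)^3; in characteristic 2 they all
  collapse to 0.\<close>

lemma card_hess_c4_zero:
  fixes w :: "'a::{finite,field}"
  assumes w: "w^2 + w + 1 = 0" and three: "(3::'a) \<noteq> 0"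
  shows "card {x::'a. x^3 \<noteq> 27 \<and> hess_c4 x = 0} = (if (2::'a) = 0 then 1 else 4)"
proof -
  note n = numeral_ne_zero_of_three[OF three]
  have "(- 6 :: 'a)^3 - 27 = - 243" "(6::'a) = 2 * 3" by simp_all
  hence m: "(- 6 :: 'a)^3 \<noteq> 27" "(6::'a) = 0 \<longleftrightarrow> (2::'a) = 0" using n(5) three
    by (metis neg_equal_0_iff_equal right_minus_eq, metis mult_eq_0_iff)
  have *: "{x::'a. x^3 \<noteq> 27 \<and> hess_c4 x = 0} = insert 0 {x. x^3 \<in> {(- 6)^3}}"
    using m(1) n by (auto simp: hess_c4_zero_iff)
  show ?thesis
  proof (cases "(2::'a) = 0")
    case True
    hence "(- 6 :: 'a)^3 = 0" using m(2) by simp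
    hence "insert 0 {x. x^3 \<in> {(- 6 :: 'a)^3}} = {0}" by auto
    moreover have "card {0::'a} = 1" by simp
    ultimately show ?thesis unfolding * by (simp only: True if_True simp_thms)
  next
    case False
    hence "(- 6 :: 'a) \<noteq> 0" using m(2) by simp
    moreover from this have "card {x. x^3 \<in> {(- 6 :: 'a)^3}} = 3 * card {(- 6 :: 'a)^3}"
      by (intro card_cube_vimage[OF w three]) blast
    ultimately show ?thesis unfolding * using False by (subst card_insert_disjoint) (simp_all del: power_minus_odd)
  qed
qed

lemma hess_c6_quadratic:
  fixes u :: "'a::field"
  assumes two: "(2::'a) \<noteq> 0" and three: "(3::'a) \<noteq> 0" and u: "u^2 - 6 * u - 18 = 0"
  shows "u \<noteq> 0" "u^3 \<noteq> (-6)^3" "u^3 \<noteq> 27" "hess_c6 u = 0" "u \<noteq> 3"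
proof -
  note n = numeral_ne_zero_of_three[OF three]
  have "(18::'a) = 2 * 9" "(54::'a) = 2 * 27" by simp_all
  hence m: "(18::'a) \<noteq> 0" "(54::'a) \<noteq> 0" using two n by (metis mult_eq_0_iff)+
  have u2: "u^2 = 6 * u + 18" using u by algebra
  have u3: "u^3 = 54 * u + 108" using u2 by algebra
  show "u \<noteq> 0" using u m by auto
  show "u^3 \<noteq> (-6)^3"
  proof
    assume "u^3 = (-6)^3"
    hence "54 * (u + 6) = 0" unfolding u3 by (simp add: algebra_simps)
    hence "u + 6 = 0" using m(2) by (metis mult_eq_0_iff)
    hence "u = - 6" by (simp add: eq_neg_iff_add_eq_0)
    hence "(54::'a) = 0" using u by simp
    thus False using m by simp
  qed
  show "u^3 \<noteq> 27"
  proof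
    assume "u^3 = 27"
    moreover have "27 * (2 * u + 3) = u^3 - 27" unfolding u3 by algebra
    ultimately have "27 * (2 * u + 3) = 0" by simp
    hence "2 * u + 3 = 0" using n by (metis mult_eq_0_iff)
    \<comment> \<open>A Bezout identity showing that 2u + 3 and the quadratic have no common root
      when 3 is invertible.\<close>
    moreover have "27 = (2 * u + 3) * (2 * u - 15) - 4 * (u^2 - 6 * u - 18)" by algebra
    ultimately have "(27::'a) = 0" using u by simp
    thus False using n by simp
  qed
  show "hess_c6 u = 0" using hess_c6_factor[of 1 u] u by simp
  show "u \<noteq> 3" using u n by auto
qed

text \<open>In characteristic 2, c6 is x^6 and vanishes only where c4 does. Otherwise one zero
  yields a fixed point z of the involution; the other is 6 - z, and the six zeros are these two
  times the cube roots of unity.\<close>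

lemma hess_c6_class:
  fixes w :: "'a::{finite,field}"
  assumes w: "w^2 + w + 1 = 0" and three: "(3::'a) \<noteq> 0"
  defines "X \<equiv> {x::'a. x^3 \<noteq> 27 \<and> hess_c4 x \<noteq> 0 \<and> hess_c6 x = 0}"
  shows "X = {} \<or> (2::'a) \<noteq> 0 \<and> card X = 6 \<and> card (hess_class ` X) = 1"
proof (cases "X = {}")
  case False
  note n = numeral_ne_zero_of_three[OF three]
  have w3: "w^3 = 1" using w by algebra
  have two: "(2::'a) \<noteq> 0"
  proof
    assume two: "(2::'a) = 0"
    have "(540::'a) = 2 * 270" "(5832::'a) = 2 * 2916" by simp_all
    hence "(540::'a) = 0" "(5832::'a) = 0" unfolding two by simp_all
    moreover obtain x where "x \<in> X" using False by blast
    ultimately show False by (auto simp: X_def hess_c4_def hess_c6_def)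
  qed
  have root: "\<exists>z. z^3 = x^3 \<and> z^2 - 6 * z - 18 = 0" if "x \<in> X" for x
  proof -
    have "hess_c6 x = ((x^2 - 6 * x - 18) * ((w * x)^2 - 6 * (w * x) - 18)) * ((w^2 * x)^2 - 6 * (w^2 * x) - 18)"
      unfolding hess_c6_def using w by algebra
    hence "x^2 - 6 * x - 18 = 0 \<or> (w * x)^2 - 6 * (w * x) - 18 = 0 \<or> (w^2 * x)^2 - 6 * (w^2 * x) - 18 = 0"
      using that unfolding X_def by (metis (mono_tags, lifting) mem_Collect_eq mult_eq_0_iff)
    moreover have "(w * x)^3 = x^3" "(w^2 * x)^3 = x^3" using w by algebra+
    ultimately show ?thesis by blast
  qed
  obtain z :: 'a where z: "z^2 - 6 * z - 18 = 0" using False root by blast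
  define z' where "z' = 6 - z"
  have z': "z'^2 - 6 * z' - 18 = 0" unfolding z'_def using z by algebra
  note q = hess_c6_quadratic[OF two three z] and q' = hess_c6_quadratic[OF two three z']
  have zz: "y = z \<or> y = z'" if "y^2 - 6 * y - 18 = 0" for y
  proof -
    have "(y - z) * (y - z') = 0" unfolding z'_def using z that by algebra
    thus ?thesis by auto
  qed
  have X: "X = {y. y^3 \<in> {z^3, z'^3}}"
  proof (intro equalityI subsetI)
    fix y assume "y \<in> X"
    thus "y \<in> {y. y^3 \<in> {z^3, z'^3}}" using root zz by fastforce
  next
    fix y assume "y \<in> {y. y^3 \<in> {z^3, z'^3}}"
    then obtain u where u: "y^3 = u^3" "u = z \<or> u = z'" by blast
    have "u \<noteq> 0 \<and> u^3 \<noteq> (-6)^3 \<and> u^3 \<noteq> 27 \<and> hess_c6 u = 0"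
        using u(2) q q' by blast
    thus "y \<in> X" using hess_cube_cong[OF u(1)] u(1)
        unfolding X_def hess_c4_zero_iff mem_Collect_eq by metis
  qed
  have ne: "z^3 \<noteq> z'^3"
  proof
    assume "z^3 = z'^3"
    then consider "z' = z" | "z' = w * z" | "z' = w^2 * z"
      using cube_eq_iff_primitive[OF w] by metis
    thus False
    proof cases
      case 1
      have "2 * (z - 3) = z - z'" unfolding z'_def by algebra
      hence "2 * (z - 3) = 0" using 1 by simp
      thus False using two q(5) by (metis mult_eq_0_iff right_minus_eq)
    next
      case 2
      have "z = - (w * (w * z - z')) - 6 * w" unfolding z'_def using w by algebra
      hence "z = - 6 * w" using 2 by simp
      hence "z^3 = (-6)^3" using w by algebra
      thus False using q(2) by simp
    next
      case 3
      have "z = - (w^2 * (w^2 * z - z')) - 6 * w^2" unfolding z'_def using w by algebra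
      hence "z = - 6 * w^2" using 3 by simp
      hence "z^3 = (-6)^3" using w by algebra
      thus False using q(2) by simp
    qed
  qed
  have "card X = 3 * card {z^3, z'^3}"
    unfolding X by (rule card_cube_vimage[OF w three]) (use q(1) q'(1) in blast)
  hence "card X = 6" using ne by simp
  moreover have "hess_class y = hess_class z" if y: "y \<in> X" for y
  proof -
    have y27: "y^3 \<noteq> 27" using y by (simp add: X_def)
    have "y^3 = z^3 \<or> y^3 = z'^3" using y X by blast
    \<comment> \<open>Although z and z' are fixed by the involution, w z and w z' are exchanged: z +
      z' = 6 and z z' = -18 turn the product into -18 (w^2 + w) + 9 = 27.\<close>
    moreover have "(w * z' - 3) * (w * z - 3) = 27" "(w * z')^3 = z'^3" "(w * z)^3 = z^3"
      unfolding z'_def using w z by algebra+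
    ultimately show ?thesis using hess_class_eq_iff[OF w three y27 q(3)] by metis
  qed
  hence "hess_class ` X = {hess_class z}" using False by blast
  ultimately show ?thesis using two by simp
qed simp

text \<open>Here k is the number of generic classes. The size q is 12k plus 3 for the singular
  parameters, plus 1 or 4 for c4 = 0, plus 0 or 6 for c6 = 0; the combination 1 and 6 cannot
  occur.\<close>

lemma hess_count:
  fixes w :: "'a::{finite,field}"
  assumes w: "w^2 + w + 1 = 0" and three: "(3::'a) \<noteq> 0"
  defines "N \<equiv> card (hess_class ` {x::'a. x^3 \<noteq> 27})"
  obtains k where "card (UNIV :: 'a set) = 12 * k + 4" "N = k + 1"
    | k where "card (UNIV :: 'a set) = 12 * k + 7" "N = k + 1"
    | k where "card (UNIV :: 'a set) = 12 * k + 13" "N = k + 2"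
proof -
  note n = numeral_ne_zero_of_three[OF three]
  define X0 where "X0 = {x::'a. x^3 \<noteq> 27 \<and> hess_c4 x = 0}"
  define X1 where "X1 = {x::'a. x^3 \<noteq> 27 \<and> hess_c4 x \<noteq> 0 \<and> hess_c6 x = 0}"
  define X2 where "X2 = {x::'a. x^3 \<noteq> 27 \<and> hess_c4 x \<noteq> 0 \<and> hess_c6 x \<noteq> 0}"
  have X: "{x::'a. x^3 \<noteq> 27} = X0 \<union> X1 \<union> X2" by (auto simp: X0_def X1_def X2_def)
  have "card {x::'a. x^3 \<in> {27}} = 3 * card {27::'a}"
    by (rule card_cube_vimage[OF w three]) (use three in \<open>auto intro!: exI[of _ 3]\<close>)
  moreover have "card (UNIV :: 'a set) = card {x::'a. x^3 \<in> {27}} + card {x::'a. x^3 \<noteq> 27}"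
    by (subst card_Un_disjoint[symmetric]) (auto intro!: arg_cong[where f = card])
  moreover have "card {x::'a. x^3 \<noteq> 27} = card X0 + card X1 + card X2"
    unfolding X by (subst card_Un_disjoint; (subst card_Un_disjoint)?) (auto simp: X0_def X1_def X2_def)
  ultimately have q: "card (UNIV :: 'a set) = 3 + card X0 + card X1 + card X2" by simp
  have eqD: "(hess_c4 x = 0 \<longleftrightarrow> hess_c4 y = 0) \<and> (hess_c6 x = 0 \<longleftrightarrow> hess_c6 y = 0)"
    if "x^3 \<noteq> 27" "y^3 \<noteq> 27" "hess_class x = hess_class y" for x y :: 'a
    using hess_class_eqD[OF w three that] by blast
  have disj: "hess_class ` X0 \<inter> hess_class ` X1 = {}" "(hess_class ` X0 \<union> hess_class ` X1) \<inter> hess_class ` X2 = {}"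
    using eqD unfolding X0_def X1_def X2_def by blast+
  have N: "N = card (hess_class ` X0) + card (hess_class ` X1) + card (hess_class ` X2)"
    unfolding N_def X image_Un using disj by (simp add: card_Un_disjoint)
  have "card X2 = 12 * card (hess_class ` X2)"
  proof (rule card_eq_mult_card_image)
    fix x assume x: "x \<in> X2"
    have "{y \<in> X2. hess_class y = hess_class x} = {y. y^3 \<noteq> 27 \<and> hess_class y = hess_class x}"
      using x eqD unfolding X2_def by blast
    thus "card {y \<in> X2. hess_class y = hess_class x} = 12"
      using card_generic_hess_class[OF w three] x unfolding X2_def by simp
  qed simp
  moreover have "card X0 = (if (2::'a) = 0 then 1 else 4)" "card (hess_class ` X0) = 1"
    unfolding X0_def by (rule card_hess_c4_zero[OF w three], rule hess_c4_class[OF w three])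
  moreover have "X1 = {} \<or> (2::'a) \<noteq> 0 \<and> card X1 = 6 \<and> card (hess_class ` X1) = 1"
    unfolding X1_def by (rule hess_c6_class[OF w three])
  ultimately show thesis using q N that by (auto split: if_splits)
qed

section \<open>The count\<close>

lemma I_GH_cube_root:
  fixes w :: "'a::{finite,field}"
  assumes w: "w^2 + w + 1 = 0" and three: "(3::'a) \<noteq> 0"
  shows "card (UNIV :: 'a set) mod 3 = 1"
    and "I_GH TYPE('a) = 3 * (card (UNIV :: 'a set) + 3) div 4"
proof -
  note n = numeral_ne_zero_of_three[OF three]
  define K where "K = (\<lambda>x::'a. x^3) ` (UNIV - {0})"
  define V where "V = UNIV - {0} - K"
  let ?q = "card (UNIV :: 'a set)"
  have K0: "0 \<notin> K" by (auto simp: K_def)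
  have "card {y::'a. y^3 \<in> K} = 3 * card K"
    by (rule card_cube_vimage[OF w three]) (auto simp: K_def)
  moreover have "{y::'a. y^3 \<in> K} = UNIV - {0}" using K0 by (auto simp: K_def)
  ultimately have "card (UNIV - {0::'a}) = 3 * card K" by simp
  moreover have "?q = Suc (card (UNIV - {0::'a}))" by (rule card.remove) simp_all
  ultimately have q: "?q = 3 * card K + 1" by (simp only: Suc_eq_plus1)
  thus "?q mod 3 = 1" by simp
  have K1: "1 \<in> K" unfolding K_def by (rule image_eqI[of _ _ 1]) simp_all
  hence Kpos: "card K > 0" by (auto simp: card_gt_0_iff)
  have cV: "card V = 2 * card K"
  proof -
    have "K \<subseteq> UNIV - {0}" using K0 by blast
    hence "card V = card (UNIV - {0::'a}) - card K" unfolding V_def by (intro card_Diff_subset) auto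
    also have "card (UNIV - {0::'a}) = ?q - 1" by (intro card_Diff_singleton) simp
    finally show ?thesis using q by simp
  qed
  define X where "X = {x::'a. x^3 \<noteq> 27}"
  have V27: "1 \<noteq> 27 * v" if "v \<in> V" for v
  proof
    assume "1 = 27 * v"
    hence "v = 1 / 27" using n(2) by (simp add: eq_divide_eq mult.commute)
    hence "v = (1 / 3)^3" by (simp add: power_divide)
    moreover have "1 / (3::'a) \<noteq> 0" using three by simp
    ultimately have "v \<in> K" unfolding K_def by blast
    thus False using that V_def by simp
  qed
  have pV: "(1, v) \<in> GH_params" "(0, v) \<in> GH_params" if "v \<in> V" for v
    using that V27[OF that] n by (auto simp: GH_params_def V_def)
  have pX: "(x, 1) \<in> GH_params" if "x \<in> X" for x
    using that by (simp add: hess_params X_def)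
  have K_mult: "l^3 * c \<in> K \<longleftrightarrow> c \<in> K" if "l \<noteq> 0" for l c
  proof
    assume "l^3 * c \<in> K"
    then obtain y where "y \<noteq> 0" "l^3 * c = y^3" by (auto simp: K_def)
    hence "c = (y / l)^3" "y / l \<noteq> 0" using that by (simp_all add: power_divide field_simps)
    thus "c \<in> K" unfolding K_def by blast
  next
    assume "c \<in> K"
    then obtain y where "y \<noteq> 0" "c = y^3" by (auto simp: K_def)
    hence "l^3 * c = (l * y)^3" "l * y \<noteq> 0" using that by (simp_all add: power_mult_distrib)
    thus "l^3 * c \<in> K" unfolding K_def by blast
  qed
  \<comment> \<open>Linking forces both v and v' to be nonzero cubes, so classes with v outside
    \<open>K\<close> are pure scaling classes.\<close>
  have cls: "(v \<in> K \<longleftrightarrow> v' \<in> K) \<and> (v \<notin> K \<longrightarrow> gh_scaled (u, v) (u', v'))"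
    if p: "(u, v) \<in> GH_params" "(u', v') \<in> GH_params" "gh_class (u, v) = gh_class (u', v')" for u v u' v'
  proof -
    have "gh_scaled (u, v) (u', v') \<or> gh_linked (u, v) (u', v')"
      using gh_class_eq_iff p by blast
    moreover have "v \<in> K \<longleftrightarrow> v' \<in> K" if "gh_scaled (u, v) (u', v')"
      using that K_mult by (auto simp: gh_scaled_def)
    moreover have "v \<in> K \<and> v' \<in> K" if lk: "gh_linked (u, v) (u', v')"
    proof -
      obtain c c' where "v = c^3" "v' = c'^3" using lk by (auto simp: gh_linked_def)
      moreover have "v \<noteq> 0" "v' \<noteq> 0" using p by (auto simp: GH_params_def)
      ultimately have "c \<noteq> 0" "c' \<noteq> 0" by auto
      thus ?thesis unfolding K_def using \<open>v = c^3\<close> \<open>v' = c'^3\<close> by blast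
    qed
    ultimately show ?thesis by blast
  qed
  define D where "D = Pair 1 ` V \<union> Pair 0 ` V \<union> (\<lambda>x. (x, 1)) ` X"
  have "I_GH TYPE('a) = card (gh_class ` D)"
  proof (rule I_GH_eq_card_image)
    show "D \<subseteq> GH_params" unfolding D_def using pV pX by blast
    fix p :: "'a \<times> 'a" assume p: "p \<in> GH_params"
    obtain u v where uv: "p = (u, v)" by fastforce
    have v: "v \<noteq> 0" "u^3 \<noteq> 27 * v" using p by (simp_all add: uv GH_params_def)
    consider "v \<in> K" | "v \<in> V" "u = 0" | "v \<in> V" "u \<noteq> 0" using v by (auto simp: V_def)
    thus "\<exists>p'\<in>D. gh_scaled p p'"
    proof cases
      case 1
      then obtain c where c: "c \<noteq> 0" "v = c^3" by (auto simp: K_def)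
      have "(u / c)^3 \<noteq> 27" using v c by (simp add: power_divide divide_eq_eq)
      hence "(u / c, 1) \<in> D" by (simp add: D_def X_def)
      moreover have "gh_scaled p (u / c, 1)" using c by (simp add: gh_scaled_def uv exI[of _ c])
      ultimately show ?thesis by blast
    next
      case 2
      hence "p \<in> D" by (simp add: D_def uv)
      thus ?thesis using gh_scaled_refl by blast
    next
      case 3
      have vu: "v = u^3 * (v / u^3)" using 3 by simp
      hence "v / u^3 \<notin> K" using K_mult[OF 3(2), of "v / u^3"] 3(1) by (simp add: V_def)
      hence "(1, v / u^3) \<in> D" using 3 v by (simp add: D_def V_def)
      moreover have "gh_scaled p (1, v / u^3)" using 3 by (simp add: gh_scaled_def uv exI[of _ u])
      ultimately show ?thesis by blast
    qed
  qed
  also have "gh_class ` D = (\<lambda>v. gh_class (1, v)) ` V \<union> (\<lambda>v. gh_class (0, v)) ` V \<union> hess_class ` X"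
    unfolding D_def image_Un image_image hess_class_def ..
  also have "card \<dots> = card ((\<lambda>v. gh_class (1, v)) ` V) + card ((\<lambda>v. gh_class (0, v)) ` V) + card (hess_class ` X)"
  proof -
    have 1: "gh_class (1, v) \<noteq> gh_class (0, v')" if "v \<in> V" "v' \<in> V" for v v'
      using cls[OF pV(1)[OF that(1)] pV(2)[OF that(2)]] that by (auto simp: V_def gh_scaled_def)
    have 2: "gh_class (1, v) \<noteq> hess_class x" "gh_class (0, v) \<noteq> hess_class x" if "v \<in> V" "x \<in> X" for v x
      using cls[OF pV(1)[OF that(1)] pX[OF that(2)]] cls[OF pV(2)[OF that(1)] pX[OF that(2)]] that K1
      by (auto simp: V_def hess_class_def)
    have "((\<lambda>v. gh_class (1, v)) ` V \<union> (\<lambda>v. gh_class (0, v)) ` V) \<inter> hess_class ` X = {}"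
      "(\<lambda>v. gh_class (1, v)) ` V \<inter> (\<lambda>v. gh_class (0, v)) ` V = {}"
      using 1 2 by blast+
    thus ?thesis by (simp add: card_Un_disjoint)
  qed
  also have "card ((\<lambda>v. gh_class (1, v)) ` V) = card V"
  proof (rule card_image, rule inj_onI)
    fix v v' assume v: "v \<in> V" "v' \<in> V" "gh_class (1, v) = gh_class (1, v')"
    hence "gh_scaled (1, v) (1, v')" using cls[OF pV(1) pV(1)] by (auto simp: V_def)
    thus "v = v'" by (auto simp: gh_scaled_def)
  qed
  \<comment> \<open>For u = 0 the class of v meets \<open>V\<close> in the coset of v modulo the
    cubes, so the number of classes is \<open>card V\<close> / \<open>card K\<close> = 2.\<close>
  also have "card ((\<lambda>v. gh_class (0, v)) ` V) = 2"
  proof -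
    have "card V = card K * card ((\<lambda>v. gh_class (0, v)) ` V)"
    proof (rule card_eq_mult_card_image)
      fix v assume v: "v \<in> V"
      have v0: "v \<noteq> 0" using v by (simp add: V_def)
      have "{y \<in> V. gh_class (0, y) = gh_class (0, v)} = (\<lambda>k. k * v) ` K"
      proof (intro equalityI subsetI)
        fix y assume "y \<in> {y \<in> V. gh_class (0, y) = gh_class (0, v)}"
        hence "gh_scaled (0, y) (0, v)" using cls[OF pV(2) pV(2)[OF v], of y] by (auto simp: V_def)
        thus "y \<in> (\<lambda>k. k * v) ` K" by (auto simp: gh_scaled_def K_def)
      next
        fix y assume "y \<in> (\<lambda>k. k * v) ` K"
        then obtain l where l: "l \<noteq> 0" "y = l^3 * v" by (auto simp: K_def)
        have y: "y \<in> V" using l v K_mult[OF l(1)] by (simp add: V_def)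
        have "gh_scaled (0, y) (0, v)" unfolding gh_scaled_def using l by auto
        thus "y \<in> {y \<in> V. gh_class (0, y) = gh_class (0, v)}"
          using y v pV gh_class_eqI by blast
      qed
      also have "card \<dots> = card K" using v0 by (intro card_image) (simp add: inj_on_def)
      finally show "card {y \<in> V. gh_class (0, y) = gh_class (0, v)} = card K" .
    qed simp
    thus ?thesis using cV Kpos by (auto simp: mult.commute)
  qed
  finally have I: "I_GH TYPE('a) = 2 * card K + 2 + card (hess_class ` X)" unfolding cV .
  \<comment> \<open>The three cases give 9k + 5, 9k + 7 and 9k + 12, where 3 (q + 3) / 4 exceeds the
    count by 1/4, 1/2 and 0.\<close>
  show "I_GH TYPE('a) = 3 * (?q + 3) div 4"
  proof (rule hess_count[OF w three, folded X_def])
    fix k assume k: "?q = 12 * k + 4" "card (hess_class ` X) = k + 1"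
    hence "card K = 4 * k + 1" using q by simp
    thus ?thesis unfolding I k by presburger
  next
    fix k assume k: "?q = 12 * k + 7" "card (hess_class ` X) = k + 1"
    hence "card K = 4 * k + 2" using q by simp
    thus ?thesis unfolding I k by presburger
  next
    fix k assume k: "?q = 12 * k + 13" "card (hess_class ` X) = k + 2"
    hence "card K = 4 * k + 4" using q by simp
    thus ?thesis unfolding I k by presburger
  qed
qed

theorem mainTheorem16:
  shows "I_GH TYPE('a::{finite,field}) =
    (if card (UNIV :: 'a set) mod 3 = 1 then (3 * (card (UNIV :: 'a set) + 3)) div 4
     else card (UNIV :: 'a set) - 1)"
proof (cases "(3::'a) = 0")
  case True
  thus ?thesis using I_GH_char_3[OF True] card_mod_3_if_char_3[OF True] by simp
next
  case three: False
  show ?thesis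
  \<comment> \<open>For invertible 3 this splits by the residue of q: a primitive cube root of unity
    exists exactly when q is 1 modulo 3.\<close>
  proof (cases "\<exists>w::'a. w^2 + w + 1 = 0")
    case True
    then obtain w :: 'a where "w^2 + w + 1 = 0" by blast
    thus ?thesis using I_GH_cube_root[OF _ three] by metis
  next
    case False
    thus ?thesis using I_GH_no_cube_root[OF three False] ex_primitive_cube_root[where ?'a = 'a] by auto
  qed
qed

end
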